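(* Let $q$ be a complex number with $0<|q|<1$, fix a choice of $q^{1/8}$, and interpret every power $q^{k/8}$ ($k\in\mathbb{Z}$) as $(q^{1/8})^k$. Put $$P=\frac{f(-q)f(-q^{3})}{q^{1/2}f(-q^{4})f(-q^{12})},\qquad Q=\frac{f(-q^{3})f(-q^{9})}{q^{3/2}f(-q^{12})f(-q^{36})}.$$ Then $$\left(PQ+\frac{16}{PQ}\right)\left(\frac{P}{Q}+\frac{Q}{P}+1\right)=\left(\frac{P}{Q}+\frac{Q}{P}\right)^3-2\left(\frac{P}{Q}+\frac{Q}{P}\right)^2-8\left(\frac{P}{Q}+\frac{Q}{P}\right)-8.$$
   Context: For $|x|<1$, $f(-x):=(x;x)_\infty=\prod_{n=1}^{\infty}(1-x^n)$ (Ramanujan's theta function, $f(-x)=\sum_{n\in\mathbb{Z}}(-1)^n x^{n(3n-1)/2}$), where $(a;x)_\infty=\prod_{n\ge 0}(1-ax^n)$. *)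

theory Defs
  imports "HOL-Analysis.Analysis"
begin

definition q_pochhammer_inf :: "complex \<Rightarrow> complex \<Rightarrow> complex" where
  "q_pochhammer_inf a x = (\<Prod>n. 1 - a * x ^ n)"

text \<open>The argument carries Ramanujan's sign: for \<open>norm x < 1\<close>, the value at \<open>- x\<close> is
  \<open>(x; x)\<close> infinite, i.e. the product of \<open>1 - x ^ n\<close> over \<open>n \<ge> 1\<close>.\<close>

definition ramanujan_f :: "complex \<Rightarrow> complex" where
  "ramanujan_f z = q_pochhammer_inf (- z) (- z)"

lemma ramanujan_f_minus: "ramanujan_f (- x) = (\<Prod>n. 1 - x ^ Suc n)"
  by (simp add: ramanujan_f_def q_pochhammer_inf_def)

lemma convergent_prod_ramanujan_f:
  fixes x :: complex
  assumes "norm x < 1"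
  shows "convergent_prod (\<lambda>n. 1 - x ^ Suc n)"
proof -
  have "summable (\<lambda>n. norm x * norm x ^ n)"
    using assms by (intro summable_mult summable_geometric) simp
  then have "summable (\<lambda>n. norm ((1 - x ^ Suc n) - 1))"
    by (simp add: norm_mult norm_power)
  then show ?thesis
    by (intro abs_convergent_prod_imp_convergent_prod summable_imp_abs_convergent_prod)
qed

end

theory Submission
  imports Defs "HOL-Complex_Analysis.Complex_Analysis"
begin

text \<open>Write \<open>U(q) = f(-q) / f(-q\<^sup>4)\<close> and \<open>u = U(q) / q\<^bsup>1/8\<^esup>\<close>, so that with the values
  \<open>a, b, c\<close> of \<open>u\<close> at \<open>q, q\<^sup>3, q\<^sup>9\<close> one has \<open>P = a b\<close> and \<open>Q = b c\<close>. The Jacobi triple product gives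
  \<open>u\<^sup>2 = 2 \<theta>\<^sub>4 / \<theta>\<^sub>2\<close>. Jacobi's quartic identity and the cubic identity
  \<open>\<theta>\<^sub>3(q) \<theta>\<^sub>3(q\<^sup>3) = \<theta>\<^sub>2(q) \<theta>\<^sub>2(q\<^sup>3) + \<theta>\<^sub>4(q) \<theta>\<^sub>4(q\<^sup>3)\<close> then yield
  \<open>(a\<^sup>4 + b\<^sup>4)\<^sup>2 = (a\<^sup>3 b\<^sup>3 + 4 a b)\<^sup>2\<close>, and for small \<open>q\<close> the leading behaviour selects the positive root.
  So \<open>a\<close> and \<open>c\<close> are roots of the same quartic over \<open>b\<close>, distinct for small \<open>q\<close>, and eliminating the
  other two roots leaves the claimed relation, which extends to the unit disc by the identity theorem.\<close>

subsection \<open>The Jacobi triple product\<close>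

definition qpoch :: "complex \<Rightarrow> nat \<Rightarrow> complex" where
  "qpoch x n = (\<Prod>k<n. 1 - x ^ Suc k)"

text \<open>Extending by zero to negative indices makes the recurrence \<open>rpoch_pred\<close> hold on all integers,
  so that the finite triple product needs no boundary cases.\<close>

definition rpoch :: "complex \<Rightarrow> int \<Rightarrow> complex" where
  "rpoch x j = (if j < 0 then 0 else inverse (qpoch x (nat j)))"

lemma one_minus_power_nonzero:
  fixes x :: complex
  assumes "norm x < 1"
  shows "1 - x ^ Suc k \<noteq> 0"
proof
  assume "1 - x ^ Suc k = 0"
  then have "norm x ^ Suc k = 1"
    by (metis eq_iff_diff_eq_0 norm_one norm_power)
  moreover have "norm x ^ Suc k < 1"
    using assms by (subst power_less_one_iff) auto
  ultimately show False by simp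
qed

lemma qpoch_nonzero: "norm x < 1 \<Longrightarrow> qpoch x n \<noteq> 0"
  using one_minus_power_nonzero unfolding qpoch_def by auto

lemma rpoch_pred:
  assumes "norm x < 1"
  shows "rpoch x (j - 1) = rpoch x j * (1 - x powi j)"
proof (cases "j \<le> 0")
  case True
  \<comment> \<open>At \<open>j = 0\<close> the factor \<open>1 - x powi 0\<close> vanishes and
    matches the zero value at -1; for negative \<open>j\<close> both sides are zero.\<close>
  then show ?thesis by (cases "j = 0") (auto simp: rpoch_def)
next
  case False
  define k where "k = nat (j - 1)"
  have k: "j = int (Suc k)" using False by (auto simp: k_def)
  have n: "nat (1 + int k) = Suc k" by simp
  have nz: "1 - x * x ^ k \<noteq> 0"
    using one_minus_power_nonzero[OF assms, of k] by simp
  show ?thesis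
    unfolding k rpoch_def power_int_of_nat using nz by (simp add: qpoch_def n)
qed

text \<open>A Pascal rule freed of its indices: \<open>A\<close> and \<open>B\<close> stand for
  \<open>x powi (n + 1 + j)\<close> and \<open>x powi (n + 1 - j)\<close>, \<open>a\<close> and
  \<open>b\<close> for \<open>rpoch x\<close> at these two indices, \<open>c\<close> for
  \<open>qpoch x (2 * n)\<close>. Since \<open>A * B = x ^ (2 * n + 2)\<close>, the left side is the
  coefficient for \<open>n + 1\<close>.\<close>

lemma finite_jacobi_triple_step:
  fixes A B x c a b :: complex
  assumes "x \<noteq> 0"
  shows "c * ((1 - A * B / x) * (1 - A * B)) * a * b =
    c * (a * (1 - A)) * (b * (1 - B)) * (1 + A * B / x)
    + c * (a * (1 - A) * (1 - A / x)) * b * B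
    + c * a * (b * (1 - B) * (1 - B / x)) * A"
  using assms by (simp add: field_simps)

text \<open>Cauchy's finite form: the coefficients are Gaussian binomials of \<open>2 * n\<close>
  over \<open>n + j\<close> in base \<open>q\<^sup>2\<close>, zero for
  \<open>\<bar>j\<bar> > n\<close>. A new pair of factors mixes the terms at \<open>j - 1\<close>,
  \<open>j\<close> and \<open>j + 1\<close>, so the induction compares coefficients.\<close>

lemma finite_jacobi_triple:
  fixes q z :: complex
  assumes q: "q \<noteq> 0" "norm q < 1" and z: "z \<noteq> 0"
  shows "((\<lambda>j::int. qpoch (q\<^sup>2) (2 * n) * rpoch (q\<^sup>2) (int n + j) * rpoch (q\<^sup>2) (int n - j)
            * (q powi (j\<^sup>2) * z powi j))
          has_sum (\<Prod>k<n. (1 + z * q ^ (2 * k + 1)) * (1 + q ^ (2 * k + 1) / z))) UNIV"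
proof (induction n)
  case 0
  have "((\<lambda>j::int. if j = 0 then 1 else 0) has_sum (1::complex)) UNIV"
    using has_sum_finite_neutralI[of "{0::int}" UNIV "\<lambda>j. if j = 0 then 1 else (0::complex)" 1] by simp
  moreover have "(if j = 0 then 1 else 0) = qpoch (q\<^sup>2) (2 * 0) * rpoch (q\<^sup>2) (int 0 + j) *
      rpoch (q\<^sup>2) (int 0 - j) * (q powi (j\<^sup>2) * z powi j)" for j
    by (auto simp: rpoch_def qpoch_def)
  ultimately show ?case by simp
next
  case (Suc n)
  define x where "x = q\<^sup>2"
  have x0: "x \<noteq> 0" and x1: "norm x < 1"
    using q by (auto simp: x_def norm_power power_less_one_iff)
  define G where "G m j = qpoch x (2 * m) * rpoch x (int m + j) * rpoch x (int m - j)" for m and j :: int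
  define t where "t j = q powi (j\<^sup>2) * z powi j" for j :: int
  define S where "S = (\<Prod>k<n. (1 + z * q ^ (2 * k + 1)) * (1 + q ^ (2 * k + 1) / z))"
  define Q where "Q = q ^ (2 * n + 1)"
  have IH: "((\<lambda>j. G n j * t j) has_sum S) UNIV"
    using Suc unfolding G_def t_def S_def x_def by (simp add: mult.assoc)
  have IHm: "((\<lambda>j. G n (j - 1) * t (j - 1)) has_sum S) UNIV"
    using IH by (subst has_sum_reindex_bij_witness[of UNIV "\<lambda>j. j + 1" "\<lambda>j. j - 1" UNIV "\<lambda>j. G n j * t j"]) auto
  have IHp: "((\<lambda>j. G n (j + 1) * t (j + 1)) has_sum S) UNIV"
    using IH by (subst has_sum_reindex_bij_witness[of UNIV "\<lambda>j. j - 1" "\<lambda>j. j + 1" UNIV "\<lambda>j. G n j * t j"]) auto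
  have *: "((\<lambda>j. (1 + Q\<^sup>2) * (G n j * t j) + z * Q * (G n (j - 1) * t (j - 1))
           + Q / z * (G n (j + 1) * t (j + 1))) has_sum
        ((1 + Q\<^sup>2) * S + z * Q * S + Q / z * S)) UNIV"
    by (intro has_sum_add has_sum_cmult_right IH IHm IHp)
  have S: "(1 + Q\<^sup>2) * S + z * Q * S + Q / z * S = (\<Prod>k<Suc n. (1 + z * q ^ (2 * k + 1)) * (1 + q ^ (2 * k + 1) / z))"
  proof -
    have "(\<Prod>k<Suc n. (1 + z * q ^ (2 * k + 1)) * (1 + q ^ (2 * k + 1) / z)) = S * ((1 + z * Q) * (1 + Q / z))"
      by (simp only: S_def Q_def prod.lessThan_Suc)
    also have "\<dots> = (1 + Q\<^sup>2) * S + z * Q * S + Q / z * S"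
      using z by (simp add: field_simps power2_eq_square)
    finally show ?thesis by simp
  qed
  have G: "(1 + Q\<^sup>2) * (G n j * t j) + z * Q * (G n (j - 1) * t (j - 1))
           + Q / z * (G n (j + 1) * t (j + 1)) = G (Suc n) j * t j" for j
  proof -
    define a b where "a = rpoch x (int (Suc n) + j)" and "b = rpoch x (int (Suc n) - j)"
    define A B where "A = x powi (int (Suc n) + j)" and "B = x powi (int (Suc n) - j)"
    have xp: "x powi k = q powi (2 * k)" for k
      unfolding x_def by (simp add: power_int_mult power_int_numeral)
    have a1: "rpoch x (int n + j) = a * (1 - A)"
      using rpoch_pred[OF x1, of "int (Suc n) + j"] by (simp add: a_def A_def algebra_simps)
    have b1: "rpoch x (int n - j) = b * (1 - B)"
      using rpoch_pred[OF x1, of "int (Suc n) - j"] by (simp add: b_def B_def algebra_simps)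
    have A1: "x powi (int n + j) = A / x"
      using x0 by (simp add: A_def power_int_add)
    have B1: "x powi (int n - j) = B / x"
      using x0 by (simp add: B_def power_int_add power_int_diff)
    have a2: "rpoch x (int n + (j - 1)) = a * (1 - A) * (1 - A / x)"
    proof -
      have e: "int n + (j - 1) = int n + j - 1" by simp
      show ?thesis unfolding e rpoch_pred[OF x1, of "int n + j"] a1 A1 ..
    qed
    have b2: "rpoch x (int n - (j + 1)) = b * (1 - B) * (1 - B / x)"
    proof -
      have e: "int n - (j + 1) = int n - j - 1" by simp
      show ?thesis unfolding e rpoch_pred[OF x1, of "int n - j"] b1 B1 ..
    qed
    have a3: "rpoch x (int n + (j + 1)) = a" by (simp add: a_def algebra_simps)
    have b3: "rpoch x (int n - (j - 1)) = b" by (simp add: b_def algebra_simps)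
    have AB: "A * B = x ^ (2 * n + 2)"
      using x0 unfolding A_def B_def by (simp flip: power_int_add power_int_of_nat)
    have Q2: "Q\<^sup>2 = A * B / x"
    proof -
      have "x * Q\<^sup>2 = A * B"
        unfolding AB by (simp add: Q_def x_def algebra_simps flip: power_mult power_add)
      then show ?thesis using x0 by (simp add: field_simps)
    qed
    have c: "qpoch x (2 * Suc n) = qpoch x (2 * n) * ((1 - A * B / x) * (1 - A * B))"
      unfolding AB using x0 by (simp add: qpoch_def mult.assoc)
    have Qi: "Q = q powi (2 * int n + 1)"
      unfolding Q_def power_int_of_nat[symmetric] by (simp add: algebra_simps)
    \<comment> \<open>Since
      \<open>2 * n + 1 + (j - 1)\<^sup>2 = 2 * (n + 1 - j) + j\<^sup>2\<close>, the shifted term is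
      \<open>B\<close> times the term at \<open>j\<close>; \<open>tp\<close> is the mirror
      image.\<close>
    have tm: "z * Q * t (j - 1) = B * t j"
    proof -
      have e: "2 * int n + 1 + (j - 1)\<^sup>2 = 2 * (int (Suc n) - j) + j\<^sup>2"
        by (simp add: power2_eq_square algebra_simps)
      have "z * Q * t (j - 1) = q powi (2 * int n + 1 + (j - 1)\<^sup>2) * (z * z powi (j - 1))"
        using q by (simp add: Qi t_def power_int_add)
      also have "\<dots> = B * t j"
        unfolding e using q z by (simp add: t_def B_def xp power_int_add power_int_diff)
      finally show ?thesis .
    qed
    have tp: "Q / z * t (j + 1) = A * t j"
    proof -
      have e: "2 * int n + 1 + (j + 1)\<^sup>2 = 2 * (int (Suc n) + j) + j\<^sup>2"
        by (simp add: power2_eq_square algebra_simps)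
      have "Q / z * t (j + 1) = q powi (2 * int n + 1 + (j + 1)\<^sup>2) * (z powi (j + 1) / z)"
        using q by (simp add: Qi t_def power_int_add)
      also have "\<dots> = A * t j"
        unfolding e using q z by (simp add: t_def A_def xp power_int_add)
      finally show ?thesis .
    qed
    have "(1 + Q\<^sup>2) * (G n j * t j) + z * Q * (G n (j - 1) * t (j - 1))
           + Q / z * (G n (j + 1) * t (j + 1))
        = ((1 + Q\<^sup>2) * G n j) * t j + G n (j - 1) * (z * Q * t (j - 1)) + G n (j + 1) * (Q / z * t (j + 1))"
      by (simp add: algebra_simps)
    also have "\<dots> = ((1 + A * B / x) * G n j + G n (j - 1) * B + G n (j + 1) * A) * t j"
      unfolding tm tp Q2 by (simp add: algebra_simps)
    also have "(1 + A * B / x) * G n j + G n (j - 1) * B + G n (j + 1) * A = G (Suc n) j"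
      unfolding G_def a1 b1 a2 b2 a3 b3 c a_def[symmetric] b_def[symmetric]
      using finite_jacobi_triple_step[OF x0, of "qpoch x (2 * n)" A B a b] by (simp add: mult.commute mult.left_commute)
    finally show ?thesis .
  qed
  show ?case
    using * unfolding S G unfolding G_def t_def x_def by (simp add: mult.assoc)
qed

subsection \<open>Theta series identities\<close>

definition Phi :: "complex \<Rightarrow> complex" where
  "Phi q = (\<Sum>\<^sub>\<infinity>n::int. q powi (n\<^sup>2))"

text \<open>This is \<theta>_2 without its factor q^(1/4), hence single valued; \<open>Phi q\<close>
  and \<open>Phi (- q)\<close> are \<theta>_3 and \<theta>_4.\<close>

definition Psi :: "complex \<Rightarrow> complex" where
  "Psi q = (\<Sum>\<^sub>\<infinity>n::int. q powi (n\<^sup>2 + n))"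

text \<open>Comparison with a two-sided geometric series. The slack 1 in the bound is needed for
  \<open>n\<^sup>2 + n\<close>, which vanishes at \<open>n = -1\<close>.\<close>

lemma abs_summable_powi:
  fixes q :: complex and g :: "int \<Rightarrow> int"
  assumes "q \<noteq> 0" "norm q < 1" and g: "\<And>n. \<bar>n\<bar> \<le> g n + 1"
  shows "(\<lambda>n. norm (q powi g n)) summable_on UNIV"
proof -
  define r where "r = norm q"
  have r: "0 < r" "r < 1" using assms by (auto simp: r_def)
  have nat: "(\<lambda>n::nat. r ^ n) summable_on UNIV"
    using r by (intro norm_summable_imp_summable_on) (simp add: norm_power)
  have "(\<lambda>n. r powi \<bar>n\<bar>) summable_on {0..}"
    by (subst summable_on_reindex_bij_witness[of "{0..}" int nat UNIV "\<lambda>n. r ^ n"])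
       (auto simp: nat power_int_def)
  moreover have "(\<lambda>n. r powi \<bar>n\<bar>) summable_on {..<0}"
  proof -
    have "(\<lambda>n::nat. r ^ Suc n) summable_on UNIV"
      using summable_on_cmult_right[OF nat, of r] by simp
    then show ?thesis
      by (subst summable_on_reindex_bij_witness[of "{..<0}" "\<lambda>n. - int (Suc n)" "\<lambda>k. nat (- k - 1)" UNIV "\<lambda>n. r ^ Suc n"])
         (auto simp: power_int_def nat_diff_distrib' simp flip: power_Suc)
  qed
  ultimately have "(\<lambda>n. r powi \<bar>n\<bar>) summable_on ({0..} \<union> {..<0})"
    by (intro summable_on_Un_disjoint) auto
  moreover have "{0..} \<union> {..<0} = (UNIV :: int set)" by auto
  ultimately have s: "(\<lambda>n::int. r powi (\<bar>n\<bar> - 1)) summable_on UNIV"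
    using r summable_on_cmult_left[of "\<lambda>n::int. r powi \<bar>n\<bar>" UNIV "inverse r"]
    by (simp add: power_int_diff divide_inverse)
  show ?thesis
  proof (rule Infinite_Sum.abs_summable_on_comparison_test'[OF s])
    fix n :: int
    have "norm (q powi g n) = r powi g n" by (simp add: r_def norm_power_int)
    also have "\<dots> \<le> r powi (\<bar>n\<bar> - 1)"
      using r g[of n] by (intro power_int_decreasing) auto
    finally show "norm (q powi g n) \<le> r powi (\<bar>n\<bar> - 1)" .
  qed
qed

lemma abs_le_square_int: "\<bar>n\<bar> \<le> n\<^sup>2" for n :: int
proof (cases "n = 0")
  case False
  then show ?thesis using self_le_power[of "\<bar>n\<bar>" 2] by simp
qed simp

lemma abs_le_square_plus_self_int: "\<bar>n\<bar> \<le> n\<^sup>2 + n + 1" for n :: int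
proof (cases "n \<ge> 0")
  case False
  have "0 \<le> (n + 1)\<^sup>2" by simp
  then show ?thesis using False by (simp add: power2_eq_square algebra_simps)
qed auto

lemma infsum_times:
  fixes f g :: "int \<Rightarrow> complex"
  assumes "(\<lambda>n. norm (f n)) summable_on UNIV" "(\<lambda>n. norm (g n)) summable_on UNIV"
  shows "(\<lambda>z. norm (case z of (m, n) \<Rightarrow> f m * g n)) summable_on UNIV"
    and "infsum f UNIV * infsum g UNIV = (\<Sum>\<^sub>\<infinity>(m, n). f m * g n)"
proof -
  have "(\<lambda>z. norm (case z of (m, n) \<Rightarrow> f m * g n)) summable_on Sigma UNIV (\<lambda>_. UNIV)"
    unfolding Infinite_Sum.abs_summable_on_Sigma_iff
  proof (intro conjI ballI)
    show "(\<lambda>y. norm (case (x, y) of (m, n) \<Rightarrow> f m * g n)) summable_on UNIV" for x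
      using summable_on_cmult_right[OF assms(2), of "norm (f x)"] by (simp add: norm_mult)
    show "(\<lambda>x. norm (infsum (\<lambda>y. norm (case (x, y) of (m, n) \<Rightarrow> f m * g n)) UNIV)) summable_on UNIV"
      using summable_on_cmult_left[OF assms(1), of "infsum (\<lambda>y. norm (g y)) UNIV"] assms(2)
      by (simp add: norm_mult infsum_cmult_right infsum_nonneg)
  qed
  then show *: "(\<lambda>z. norm (case z of (m, n) \<Rightarrow> f m * g n)) summable_on UNIV" by simp
  have "(\<lambda>(m, n). f m * g n) summable_on Sigma UNIV (\<lambda>_. UNIV)"
    using abs_summable_summable[OF *] by simp
  from infsum_Sigma'_banach[OF this]
  have "(\<Sum>\<^sub>\<infinity>(m, n). f m * g n) = (\<Sum>\<^sub>\<infinity>m. \<Sum>\<^sub>\<infinity>n. f m * g n)" by simp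
  also have "\<dots> = infsum f UNIV * infsum g UNIV"
    using assms by (simp add: infsum_cmult_right infsum_cmult_left abs_summable_summable)
  finally show "infsum f UNIV * infsum g UNIV = (\<Sum>\<^sub>\<infinity>(m, n). f m * g n)" by simp
qed

text \<open>The pairs with even \<open>m + n\<close> form a sublattice of index 2, parametrised by
  \<open>(a + b, a - b)\<close>. Its other coset gets two parametrisations: with
  \<open>(a + b, a - b - 1)\<close> the exponents of \<open>Psi\<close> products separate in
  \<open>a\<close> and \<open>b\<close>, with \<open>(a + b + 1, a - b)\<close> those of
  \<open>Phi\<close> squares.\<close>

lemma infsum_parity:
  fixes f :: "int \<times> int \<Rightarrow> complex"
  assumes "(\<lambda>n. norm (f n)) summable_on UNIV"
  shows "infsum f UNIV = (\<Sum>\<^sub>\<infinity>(a, b). f (a + b, a - b)) + (\<Sum>\<^sub>\<infinity>(a, b). f (a + b, a - b - 1))"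
    and "infsum f UNIV = (\<Sum>\<^sub>\<infinity>(a, b). f (a + b, a - b)) + (\<Sum>\<^sub>\<infinity>(a, b). f (a + b + 1, a - b))"
proof -
  let ?E = "{(m, n). even (m + n :: int)}" and ?O = "{(m, n). odd (m + n :: int)}"
  have U: "UNIV = ?E \<union> ?O" by auto
  have s: "f summable_on A" for A
    using assms abs_summable_summable summable_on_subset_banach by blast
  have e: "(m + n) div 2 + (m - n) div 2 = m" "(m + n) div 2 - (m - n) div 2 = n"
    if "even m = even n" for m n :: int using that by presburger+
  have o: "(m + n) div 2 + 1 + (m - n) div 2 = m"
    "(m + n) div 2 + (m - n) div 2 + 1 = m" "(m + n) div 2 - (m - n) div 2 = n"
    if "even m \<noteq> even n" for m n :: int using that by presburger+
  have "infsum f UNIV = infsum f ?E + infsum f ?O"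
    unfolding U by (intro infsum_Un_disjoint s) auto
  moreover have "infsum f ?E = (\<Sum>\<^sub>\<infinity>(a, b). f (a + b, a - b))"
    by (rule infsum_reindex_bij_witness[of _ "\<lambda>(a, b). (a + b, a - b)" "\<lambda>(m, n). ((m + n) div 2, (m - n) div 2)"])
       (auto simp: e)
  moreover have "infsum f ?O = (\<Sum>\<^sub>\<infinity>(a, b). f (a + b, a - b - 1))"
    by (rule infsum_reindex_bij_witness[of _ "\<lambda>(a, b). (a + b, a - b - 1)" "\<lambda>(m, n). ((m + n) div 2 + 1, (m - n) div 2)"])
       (auto simp: o)
  moreover have "infsum f ?O = (\<Sum>\<^sub>\<infinity>(a, b). f (a + b + 1, a - b))"
    by (rule infsum_reindex_bij_witness[of _ "\<lambda>(a, b). (a + b + 1, a - b)" "\<lambda>(m, n). ((m + n) div 2, (m - n) div 2)"])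
       (auto simp: o)
  ultimately show "infsum f UNIV = (\<Sum>\<^sub>\<infinity>(a, b). f (a + b, a - b)) + (\<Sum>\<^sub>\<infinity>(a, b). f (a + b, a - b - 1))"
    "infsum f UNIV = (\<Sum>\<^sub>\<infinity>(a, b). f (a + b, a - b)) + (\<Sum>\<^sub>\<infinity>(a, b). f (a + b + 1, a - b))"
    by simp_all
qed

context
  fixes q :: complex
  assumes q: "q \<noteq> 0" "norm q < 1"
begin

lemma summable_Phi: "(\<lambda>n::int. norm (q powi (n\<^sup>2))) summable_on UNIV"
  by (rule abs_summable_powi[OF q]) (use abs_le_square_int in \<open>simp add: add_increasing2\<close>)

lemma summable_Phi_minus: "(\<lambda>n::int. norm ((- q) powi (n\<^sup>2))) summable_on UNIV"
  using summable_Phi by (simp add: norm_power_int)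

lemma summable_Psi: "(\<lambda>n::int. norm (q powi (n\<^sup>2 + n))) summable_on UNIV"
  by (rule abs_summable_powi[OF q]) (rule abs_le_square_plus_self_int)

end

section \<open>Quadratic, quartic and cubic relations between the theta series\<close>

lemma powi_mult_powi: "q \<noteq> 0 \<Longrightarrow> q powi a * q powi b = q powi (a + b)" for q :: complex
  by (simp add: power_int_add)

lemma power_powi: "(q ^ k) powi n = q powi (int k * n)" for q :: complex
  by (simp add: power_int_mult)

lemma minus_powi_square: "(- q) powi (n\<^sup>2) = (if even n then q powi (n\<^sup>2) else - (q powi (n\<^sup>2)))" for q :: complex
  by (simp add: power_int_minus_left)

lemma norm_power_less_one: "norm q < 1 \<Longrightarrow> 0 < k \<Longrightarrow> norm (q ^ k) < 1" for q :: complex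
  by (simp add: norm_power power_less_one_iff)

text \<open>Rotating the form \<open>m\<^sup>2 + n\<^sup>2\<close> by 45 degrees gives a
  \<open>Phi\<close> square on the even coset and a \<open>Psi\<close> square on the odd one.
  Replacing \<open>q\<close> by \<open>- q\<close> brings in the sign (-1)^(m + n), which flips only
  the odd coset.\<close>

lemma Phi_square:
  assumes q: "q \<noteq> 0" "norm q < 1"
  shows "Phi q ^ 2 = Phi (q\<^sup>2) ^ 2 + q * Psi (q\<^sup>2) ^ 2"
    and "Phi (- q) ^ 2 = Phi (q\<^sup>2) ^ 2 - q * Psi (q\<^sup>2) ^ 2"
proof -
  note q2 = q(1)[THEN power_not_zero, of 2] norm_power_less_one[OF q(2), of 2, simplified]
  have e: "(a + b)\<^sup>2 + (a - b)\<^sup>2 = 2 * a\<^sup>2 + 2 * b\<^sup>2"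
    "(a + b + 1)\<^sup>2 + (a - b)\<^sup>2 = 1 + (2 * (a\<^sup>2 + a) + 2 * (b\<^sup>2 + b))" for a b :: int
    by (simp_all add: power2_eq_square algebra_simps)
  have A: "(\<Sum>\<^sub>\<infinity>(a, b). q powi ((a + b)\<^sup>2 + (a - b)\<^sup>2)) = Phi (q\<^sup>2) ^ 2"
    unfolding e power2_eq_square[of "Phi (q\<^sup>2)"]
    unfolding Phi_def infsum_times(2)[OF summable_Phi[OF q2] summable_Phi[OF q2]]
    using q by (simp add: power_powi power_int_add)
  have B: "(\<Sum>\<^sub>\<infinity>(a, b). q powi ((a + b + 1)\<^sup>2 + (a - b)\<^sup>2)) = q * Psi (q\<^sup>2) ^ 2"
    unfolding e power2_eq_square[of "Psi (q\<^sup>2)"]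
    unfolding Psi_def infsum_times(2)[OF summable_Psi[OF q2] summable_Psi[OF q2]]
    using q by (simp add: power_powi power_int_add case_prod_unfold flip: infsum_cmult_right')
  show "Phi q ^ 2 = Phi (q\<^sup>2) ^ 2 + q * Psi (q\<^sup>2) ^ 2"
    unfolding power2_eq_square[of "Phi q"] unfolding Phi_def[of q] infsum_times(2)[OF summable_Phi[OF q] summable_Phi[OF q]]
      infsum_parity(2)[OF infsum_times(1)[OF summable_Phi[OF q] summable_Phi[OF q]]]
    using q A B by (simp flip: power_int_add)
  have o: "(- q) powi ((a + b)\<^sup>2) * (- q) powi ((a - b)\<^sup>2) = q powi ((a + b)\<^sup>2 + (a - b)\<^sup>2)"
    "(- q) powi ((a + b + 1)\<^sup>2) * (- q) powi ((a - b)\<^sup>2) = - (q powi ((a + b + 1)\<^sup>2 + (a - b)\<^sup>2))" for a b :: int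
    using q by (auto simp: minus_powi_square power_int_add)
  show "Phi (- q) ^ 2 = Phi (q\<^sup>2) ^ 2 - q * Psi (q\<^sup>2) ^ 2"
    unfolding power2_eq_square[of "Phi (- q)"] unfolding Phi_def[of "- q"] infsum_times(2)[OF summable_Phi_minus[OF q] summable_Phi_minus[OF q]]
      infsum_parity(2)[OF infsum_times(1)[OF summable_Phi_minus[OF q] summable_Phi_minus[OF q]]]
    using q A B by (simp add: o case_prod_unfold infsum_uminus)
qed

text \<open>After the same rotation both cosets contribute the same mixed product, whence the factor
  2.\<close>

lemma Psi_square:
  assumes q: "q \<noteq> 0" "norm q < 1"
  shows "Psi q ^ 2 = 2 * Psi (q\<^sup>2) * Phi (q\<^sup>2)"
proof -
  note q2 = q(1)[THEN power_not_zero, of 2] norm_power_less_one[OF q(2), of 2, simplified]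
  have e: "((a + b)\<^sup>2 + (a + b)) + ((a - b)\<^sup>2 + (a - b)) = 2 * (a\<^sup>2 + a) + 2 * b\<^sup>2"
    "((a + b)\<^sup>2 + (a + b)) + ((a - b - 1)\<^sup>2 + (a - b - 1)) = 2 * a\<^sup>2 + 2 * (b\<^sup>2 + b)" for a b :: int
    by (simp_all add: power2_eq_square algebra_simps)
  have A: "(\<Sum>\<^sub>\<infinity>(a, b). q powi (((a + b)\<^sup>2 + (a + b)) + ((a - b)\<^sup>2 + (a - b)))) = Psi (q\<^sup>2) * Phi (q\<^sup>2)"
    unfolding e Phi_def Psi_def infsum_times(2)[OF summable_Psi[OF q2] summable_Phi[OF q2]]
    using q by (simp add: power_powi power_int_add)
  have B: "(\<Sum>\<^sub>\<infinity>(a, b). q powi (((a + b)\<^sup>2 + (a + b)) + ((a - b - 1)\<^sup>2 + (a - b - 1)))) = Phi (q\<^sup>2) * Psi (q\<^sup>2)"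
    unfolding e Phi_def Psi_def infsum_times(2)[OF summable_Phi[OF q2] summable_Psi[OF q2]]
    using q by (simp add: power_powi power_int_add)
  show ?thesis
    unfolding power2_eq_square[of "Psi q"] unfolding Psi_def[of q] infsum_times(2)[OF summable_Psi[OF q] summable_Psi[OF q]]
      infsum_parity(1)[OF infsum_times(1)[OF summable_Psi[OF q] summable_Psi[OF q]]]
    by (simp only: prod.case powi_mult_powi[OF q(1)] A B) simp
qed

text \<open>Jacobi's quartic identity: the squares of the two formulas in \<open>Phi_square\<close>
  differ by four times the product of their summands, which \<open>Psi_square\<close>
  recognises.\<close>

lemma Phi_quartic:
  assumes q: "q \<noteq> 0" "norm q < 1"
  shows "Phi q ^ 4 = q * Psi q ^ 4 + Phi (- q) ^ 4"
proof -
  have "Phi q ^ 4 = (Phi q ^ 2) ^ 2" "Phi (- q) ^ 4 = (Phi (- q) ^ 2) ^ 2" "Psi q ^ 4 = (Psi q ^ 2) ^ 2"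
    by (simp_all flip: power_mult)
  then show ?thesis
    unfolding Phi_square[OF q] Psi_square[OF q] by (simp add: power2_eq_square algebra_simps)
qed

text \<open>Splitting \<open>m\<^sup>2 + 3 * n\<^sup>2\<close> by the parity of \<open>m + n\<close>
  gives \<open>C + D\<close> at \<open>q\<close> and \<open>C - D\<close> at \<open>- q\<close>. It
  remains to see that the \<open>Psi\<close> term is \<open>2 * D\<close>.\<close>

lemma Phi_cubic:
  assumes q: "q \<noteq> 0" "norm q < 1"
  shows "Phi q * Phi (q ^ 3) = q * Psi q * Psi (q ^ 3) + Phi (- q) * Phi (- (q ^ 3))"
proof -
  note q3 = q(1)[THEN power_not_zero, of 3] norm_power_less_one[OF q(2), of 3, simplified]
  define N where "N a b = (a + b + 1)\<^sup>2 + 3 * (a - b)\<^sup>2" for a b :: int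
  define D where "D = (\<Sum>\<^sub>\<infinity>(a, b). q powi N a b)"
  define C where "C = (\<Sum>\<^sub>\<infinity>(a, b). q powi ((a + b)\<^sup>2 + 3 * (a - b)\<^sup>2))"
  have p: "Phi q * Phi (q ^ 3) = C + D"
    unfolding Phi_def infsum_times(2)[OF summable_Phi[OF q] summable_Phi[OF q3]]
      infsum_parity(2)[OF infsum_times(1)[OF summable_Phi[OF q] summable_Phi[OF q3]]]
    using q by (simp add: C_def D_def N_def power_powi powi_mult_powi)
  have o: "(- q) powi ((a + b)\<^sup>2) * (- (q ^ 3)) powi ((a - b)\<^sup>2) = q powi ((a + b)\<^sup>2 + 3 * (a - b)\<^sup>2)"
    "(- q) powi ((a + b + 1)\<^sup>2) * (- (q ^ 3)) powi ((a - b)\<^sup>2) = - (q powi N a b)" for a b :: int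
    using q by (auto simp: minus_powi_square power_int_add N_def power_powi)
  have m: "Phi (- q) * Phi (- (q ^ 3)) = C - D"
    unfolding Phi_def infsum_times(2)[OF summable_Phi_minus[OF q] summable_Phi_minus[OF q3]]
      infsum_parity(2)[OF infsum_times(1)[OF summable_Phi_minus[OF q] summable_Phi_minus[OF q3]]]
    by (simp add: C_def D_def o case_prod_unfold infsum_uminus)
  txt \<open>The form \<open>N a b = 4 (a\<^sup>2 - a b + b\<^sup>2) + 2 (a + b) + 1\<close> is hexagonal: each parity class of
    \<open>q * Psi q * Psi (q ^ 3)\<close> is carried to it by an automorphism of the lattice.\<close>
  have e: "1 + (((a + b)\<^sup>2 + (a + b)) + 3 * ((a - b)\<^sup>2 + (a - b))) = N a (a - b)"
    "1 + (((a + b)\<^sup>2 + (a + b)) + 3 * ((a - b - 1)\<^sup>2 + (a - b - 1))) = N (b - a) b" for a b :: int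
    by (simp_all add: N_def power2_eq_square algebra_simps)
  have D1: "(\<Sum>\<^sub>\<infinity>(a, b). q powi N a (a - b)) = D"
    unfolding D_def by (rule infsum_reindex_bij_witness[of _ "\<lambda>(a, b). (a, a - b)" "\<lambda>(a, b). (a, a - b)"]) auto
  have D2: "(\<Sum>\<^sub>\<infinity>(a, b). q powi N (b - a) b) = D"
    unfolding D_def by (rule infsum_reindex_bij_witness[of _ "\<lambda>(a, b). (b - a, b)" "\<lambda>(a, b). (b - a, b)"]) auto
  have mul: "q * (q powi m * q powi (3 * n)) = q powi (1 + (m + 3 * n))" for m n
    using q by (simp add: power_int_add)
  have "q * (Psi q * Psi (q ^ 3)) = D + D"
    unfolding Psi_def infsum_times(2)[OF summable_Psi[OF q] summable_Psi[OF q3]]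
      infsum_parity(1)[OF infsum_times(1)[OF summable_Psi[OF q] summable_Psi[OF q3]]]
    unfolding distrib_left[of q] infsum_cmult_right'[symmetric] case_prod_unfold fst_conv snd_conv power_powi of_nat_numeral mul e
    using D1 D2 by (simp add: case_prod_unfold)
  then show ?thesis unfolding p m by (simp add: mult.assoc)
qed

subsection \<open>Product forms of the theta series\<close>

text \<open>Dominated convergence for the counting measure, since absolutely summable sums are
  integrals over \<open>count_space UNIV\<close>.\<close>

lemma tannery_infsum:
  fixes f :: "nat \<Rightarrow> 'a \<Rightarrow> complex"
  assumes w: "w summable_on UNIV" and bound: "\<And>n j. norm (f n j) \<le> w j"
    and lim: "\<And>j. (\<lambda>n. f n j) \<longlonglongrightarrow> g j"
  shows "(\<lambda>n. infsum (f n) UNIV) \<longlonglongrightarrow> infsum g UNIV"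
proof -
  have g: "norm (g j) \<le> w j" for j
    using tendsto_norm[OF lim[of j]] bound by (intro LIMSEQ_le_const2) auto
  have w0: "norm (w j) = w j" for j
    using order_trans[OF norm_ge_zero bound[of 0 j]] by simp
  have eq: "infsum h UNIV = integral\<^sup>L (count_space UNIV) h" if "\<And>j. norm (h j) \<le> w j" for h :: "'a \<Rightarrow> complex"
  proof -
    have "(\<lambda>j. norm (h j)) summable_on UNIV"
      by (rule Infinite_Sum.abs_summable_on_comparison_test'[OF w that])
    then show ?thesis
      by (subst infsetsum_infsum[symmetric]) (simp_all add: abs_summable_equivalent infsetsum_def)
  qed
  have "integrable (count_space UNIV) w"
    using w w0 by (simp flip: abs_summable_equivalent abs_summable_on_def)
  then have "(\<lambda>n. integral\<^sup>L (count_space UNIV) (f n)) \<longlonglongrightarrow> integral\<^sup>L (count_space UNIV) g"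
    by (rule integral_dominated_convergence[rotated 2]) (use bound lim in auto)
  then show ?thesis by (simp add: eq bound g)
qed

lemma qpoch_tendsto: "norm x < 1 \<Longrightarrow> qpoch x \<longlonglongrightarrow> ramanujan_f (- x)"
  unfolding qpoch_def ramanujan_f_minus
  using convergent_prod_LIMSEQ[OF convergent_prod_ramanujan_f] LIMSEQ_lessThan_iff_atMost by blast

lemma ramanujan_f_nonzero:
  assumes "norm x < 1"
  shows "ramanujan_f (- x) \<noteq> 0"
  unfolding ramanujan_f_minus
  using prodinf_nonzero[OF convergent_prod_ramanujan_f[OF assms]] one_minus_power_nonzero[OF assms] by blast

text \<open>Let \<open>n\<close> tend to infinity in the finite form: each coefficient tends to
  \<open>E * inverse E * inverse E\<close>, and Tannery's theorem exchanges limit and sum.\<close>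

lemma jacobi_triple_limit:
  fixes q z :: complex
  assumes q: "q \<noteq> 0" "norm q < 1" and z: "z \<noteq> 0"
    and s: "(\<lambda>j::int. norm (q powi (j\<^sup>2) * z powi j)) summable_on UNIV"
  shows "(\<lambda>n. \<Prod>k<n. (1 + z * q ^ (2 * k + 1)) * (1 + q ^ (2 * k + 1) / z))
    \<longlonglongrightarrow> (\<Sum>\<^sub>\<infinity>j::int. q powi (j\<^sup>2) * z powi j) / ramanujan_f (- (q\<^sup>2))"
proof -
  define x where "x = q\<^sup>2"
  define E where "E = ramanujan_f (- x)"
  define t where "t j = q powi (j\<^sup>2) * z powi j" for j
  have x: "norm x < 1" using norm_power_less_one[OF q(2)] by (simp add: x_def)
  have E0: "E \<noteq> 0" using ramanujan_f_nonzero[OF x] by (simp add: E_def)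
  have lim: "qpoch x \<longlonglongrightarrow> E" using qpoch_tendsto[OF x] by (simp add: E_def)
  have ilim: "(\<lambda>n. inverse (qpoch x n)) \<longlonglongrightarrow> inverse E"
    by (intro tendsto_inverse lim E0)
  \<comment> \<open>\<open>qpoch x\<close> converges to a nonzero limit, so it and its reciprocals
    are bounded; \<open>M * K * K\<close> times the norm of the theta term is the dominating
    series.\<close>
  obtain M where M: "\<And>n. norm (qpoch x n) \<le> M"
    using convergent_imp_Bseq[of "qpoch x"] lim unfolding convergent_def Bseq_def by blast
  obtain K where K: "K > 0" "\<And>n. norm (inverse (qpoch x n)) \<le> K"
    using convergent_imp_Bseq[of "\<lambda>n. inverse (qpoch x n)"] ilim unfolding convergent_def Bseq_def by blast
  have rK: "norm (rpoch x j) \<le> K" for j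
    using K by (auto simp: rpoch_def)
  have rlim: "(\<lambda>n. rpoch x (int n + j)) \<longlonglongrightarrow> inverse E" for j
  proof -
    have "filterlim (\<lambda>n. nat (int n + j)) at_top sequentially"
      unfolding filterlim_at_top
    proof
      fix Z :: nat
      show "\<forall>\<^sub>F n in sequentially. Z \<le> nat (int n + j)"
        using eventually_ge_at_top[of "Z + nat (- j)"] by eventually_elim linarith
    qed
    from filterlim_compose[OF ilim this]
    have "(\<lambda>n. inverse (qpoch x (nat (int n + j)))) \<longlonglongrightarrow> inverse E" .
    moreover have "\<forall>\<^sub>F n in sequentially. inverse (qpoch x (nat (int n + j))) = rpoch x (int n + j)"
      using eventually_ge_at_top[of "nat (- j)"] by eventually_elim (simp add: rpoch_def)
    ultimately show ?thesis by (rule Lim_transform_eventually)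
  qed
  have rlim': "(\<lambda>n. rpoch x (int n - j)) \<longlonglongrightarrow> inverse E" for j
    using rlim[of "- j"] by simp
  have clim: "(\<lambda>n. qpoch x (2 * n)) \<longlonglongrightarrow> E"
    by (rule filterlim_compose[OF lim]) (simp add: filterlim_subseq strict_mono_def)
  have "(\<lambda>n. infsum (\<lambda>j. qpoch x (2 * n) * rpoch x (int n + j) * rpoch x (int n - j) * t j) UNIV)
      \<longlonglongrightarrow> infsum (\<lambda>j. E * inverse E * inverse E * t j) UNIV"
  proof (rule tannery_infsum)
    show "(\<lambda>j. M * K * K * norm (t j)) summable_on UNIV"
      using s by (intro summable_on_cmult_right) (simp add: t_def)
    show "norm (qpoch x (2 * n) * rpoch x (int n + j) * rpoch x (int n - j) * t j) \<le> M * K * K * norm (t j)" for n j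
      unfolding norm_mult using M[of 0] order_trans[OF norm_ge_zero M[of 0]] K(1)
      by (intro mult_mono M rK) auto
    show "(\<lambda>n. qpoch x (2 * n) * rpoch x (int n + j) * rpoch x (int n - j) * t j)
      \<longlonglongrightarrow> E * inverse E * inverse E * t j" for j
      by (intro tendsto_mult clim rlim rlim' tendsto_const)
  qed
  moreover have "infsum (\<lambda>j. qpoch x (2 * n) * rpoch x (int n + j) * rpoch x (int n - j) * t j) UNIV
      = (\<Prod>k<n. (1 + z * q ^ (2 * k + 1)) * (1 + q ^ (2 * k + 1) / z))" for n
    unfolding x_def t_def by (rule infsumI[OF finite_jacobi_triple[OF q z]])
  moreover have "infsum (\<lambda>j. E * inverse E * inverse E * t j) UNIV = infsum t UNIV / E"
    using E0 by (simp add: infsum_cmult_right' divide_inverse)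
  ultimately show ?thesis
    by (simp add: E_def x_def t_def[abs_def])
qed

text \<open>The triple product at \<open>z = -1\<close>: both factors become
  \<open>1 - q ^ (2 * k + 1)\<close>, and the product over odd exponents is the full product divided
  by the one over even exponents.\<close>

lemma Phi_product:
  assumes q: "q \<noteq> 0" "norm q < 1"
  shows "Phi (- q) * ramanujan_f (- (q\<^sup>2)) = ramanujan_f (- q) ^ 2"
proof -
  note q2 = norm_power_less_one[OF q(2), of 2, simplified]
  note E = ramanujan_f_nonzero[OF q2]
  have e: "q powi (j\<^sup>2) * (- 1) powi j = (- q) powi (j\<^sup>2)" for j :: int
    by (auto simp: minus_powi_square power_int_minus_left)
  have p: "(\<Prod>k<n. (1 + (- 1) * q ^ (2 * k + 1)) * (1 + q ^ (2 * k + 1) / (- 1)))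
      = (qpoch q (2 * n) / qpoch (q\<^sup>2) n)\<^sup>2" for n
  proof -
    have "(\<Prod>k<n. 1 - q ^ (2 * k + 1)) * qpoch (q\<^sup>2) n = qpoch q (2 * n)"
    proof (induction n)
      case (Suc n)
      have "(\<Prod>k<Suc n. 1 - q ^ (2 * k + 1)) * qpoch (q\<^sup>2) (Suc n)
        = ((\<Prod>k<n. 1 - q ^ (2 * k + 1)) * qpoch (q\<^sup>2) n) * ((1 - q ^ (2 * n + 1)) * (1 - (q\<^sup>2) ^ Suc n))"
        by (simp add: qpoch_def)
      also have "(q\<^sup>2) ^ Suc n = q ^ Suc (2 * n + 1)"
        by (simp add: power_mult power2_eq_square)
      finally show ?case unfolding Suc.IH by (simp add: qpoch_def)
    qed (simp add: qpoch_def)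
    then have "(\<Prod>k<n. 1 - q ^ (2 * k + 1)) = qpoch q (2 * n) / qpoch (q\<^sup>2) n"
      using qpoch_nonzero[OF q2, of n] by (simp add: field_simps)
    then show ?thesis by (simp add: power2_eq_square prod.distrib)
  qed
  have "(\<lambda>n. (qpoch q (2 * n) / qpoch (q\<^sup>2) n)\<^sup>2) \<longlonglongrightarrow> Phi (- q) / ramanujan_f (- (q\<^sup>2))"
    using jacobi_triple_limit[OF q, of "- 1"] summable_Phi_minus[OF q] unfolding e p
    by (simp add: Phi_def)
  moreover have "(\<lambda>n. qpoch q (2 * n)) \<longlonglongrightarrow> ramanujan_f (- q)"
    by (rule filterlim_compose[OF qpoch_tendsto[OF q(2)]]) (simp add: filterlim_subseq strict_mono_def)
  then have "(\<lambda>n. (qpoch q (2 * n) / qpoch (q\<^sup>2) n)\<^sup>2) \<longlonglongrightarrow> (ramanujan_f (- q) / ramanujan_f (- (q\<^sup>2)))\<^sup>2"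
    by (intro tendsto_power tendsto_divide qpoch_tendsto q2 E)
  ultimately have "Phi (- q) / ramanujan_f (- (q\<^sup>2)) = (ramanujan_f (- q) / ramanujan_f (- (q\<^sup>2)))\<^sup>2"
    by (rule LIMSEQ_unique)
  then show ?thesis using E by (simp add: field_simps power2_eq_square)
qed

text \<open>The triple product at \<open>z = q\<close>, with
  \<open>1 + y = (1 - y\<^sup>2) / (1 - y)\<close> applied to the even powers of
  \<open>q\<close>.\<close>

lemma Psi_product:
  assumes q: "q \<noteq> 0" "norm q < 1"
  shows "Psi q * ramanujan_f (- (q\<^sup>2)) = 2 * ramanujan_f (- (q ^ 4)) ^ 2"
proof -
  note q2 = norm_power_less_one[OF q(2), of 2, simplified]
  note q4 = norm_power_less_one[OF q(2), of 4, simplified]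
  note E = ramanujan_f_nonzero[OF q2]
  have e: "q powi (j\<^sup>2) * q powi j = q powi (j\<^sup>2 + j)" for j :: int
    using q by (simp add: power_int_add)
  \<comment> \<open>The second factor runs over the exponents \<open>0, 2, ..., 2 * n - 2\<close>,
    the first over \<open>2, ..., 2 * n\<close>. The extra \<open>1 + (q\<^sup>2) ^ n\<close>, which
    tends to 1, makes up the difference, and exponent 0 leaves the 2.\<close>
  have p: "(\<Prod>k<n. (1 + q * q ^ (2 * k + 1)) * (1 + q ^ (2 * k + 1) / q)) * (1 + (q\<^sup>2) ^ n)
      = 2 * (qpoch (q ^ 4) n / qpoch (q\<^sup>2) n)\<^sup>2" for n
  proof -
    have "(\<Prod>k<n. 1 + q * q ^ (2 * k + 1)) * qpoch (q\<^sup>2) n = qpoch (q ^ 4) n"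
    proof (induction n)
      case (Suc n)
      have "(1 + q * q ^ (2 * n + 1)) * (1 - (q\<^sup>2) ^ Suc n) = 1 - (q ^ 4) ^ Suc n"
        by (simp add: algebra_simps power_mult power2_eq_square power4_eq_xxxx power_mult_distrib)
      moreover have "(\<Prod>k<Suc n. 1 + q * q ^ (2 * k + 1)) * qpoch (q\<^sup>2) (Suc n)
        = ((\<Prod>k<n. 1 + q * q ^ (2 * k + 1)) * qpoch (q\<^sup>2) n)
          * ((1 + q * q ^ (2 * n + 1)) * (1 - (q\<^sup>2) ^ Suc n))"
        by (simp add: qpoch_def)
      ultimately show ?case unfolding Suc.IH by (simp add: qpoch_def)
    qed (simp add: qpoch_def)
    then have R: "(\<Prod>k<n. 1 + q * q ^ (2 * k + 1)) = qpoch (q ^ 4) n / qpoch (q\<^sup>2) n"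
      using qpoch_nonzero[OF q2, of n] by (simp add: field_simps)
    have R2: "(\<Prod>k<n. 1 + q ^ (2 * k + 1) / q) * (1 + (q\<^sup>2) ^ n) = 2 * (\<Prod>k<n. 1 + q * q ^ (2 * k + 1))"
    proof (induction n)
      case (Suc n)
      have "(\<Prod>k<Suc n. 1 + q ^ (2 * k + 1) / q) * (1 + (q\<^sup>2) ^ Suc n)
        = (\<Prod>k<n. 1 + q ^ (2 * k + 1) / q) * (1 + (q\<^sup>2) ^ n) * (1 + q * q ^ (2 * n + 1))"
        using q by (simp add: power_mult power2_eq_square)
      then show ?case unfolding Suc.IH by simp
    qed simp
    show ?thesis unfolding prod.distrib mult.assoc R2 unfolding R by (simp add: power2_eq_square)
  qed
  have "(\<lambda>n. \<Prod>k<n. (1 + q * q ^ (2 * k + 1)) * (1 + q ^ (2 * k + 1) / q)) \<longlonglongrightarrow> Psi q / ramanujan_f (- (q\<^sup>2))"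
    using jacobi_triple_limit[OF q q(1)] summable_Psi[OF q] unfolding e
    by (simp add: Psi_def)
  then have "(\<lambda>n. (\<Prod>k<n. (1 + q * q ^ (2 * k + 1)) * (1 + q ^ (2 * k + 1) / q)) * (1 + (q\<^sup>2) ^ n))
    \<longlonglongrightarrow> Psi q / ramanujan_f (- (q\<^sup>2)) * (1 + 0)"
    by (intro tendsto_mult tendsto_add tendsto_const LIMSEQ_power_zero q2)
  moreover have "(\<lambda>n. 2 * (qpoch (q ^ 4) n / qpoch (q\<^sup>2) n)\<^sup>2) \<longlonglongrightarrow> 2 * (ramanujan_f (- (q ^ 4)) / ramanujan_f (- (q\<^sup>2)))\<^sup>2"
    by (intro tendsto_mult tendsto_power tendsto_divide tendsto_const qpoch_tendsto q2 q4 E)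
  ultimately have "Psi q / ramanujan_f (- (q\<^sup>2)) * (1 + 0) = 2 * (ramanujan_f (- (q ^ 4)) / ramanujan_f (- (q\<^sup>2)))\<^sup>2"
    unfolding p by (rule LIMSEQ_unique)
  then show ?thesis using E by (simp add: field_simps power2_eq_square)
qed

subsection \<open>Algebraic elimination\<close>

text \<open>Inserting the first relation turns the second into \<open>X * Y = K\<close> and the
  third into a quadratic \<open>L = 0\<close> for \<open>Y\<close> over \<open>t\<close>. Then
  \<open>X\<close> and its conjugate have product 16 and a sum that depends on \<open>t\<close>
  alone.\<close>

lemma palindromic_elimination:
  fixes t X Y z :: complex
  assumes Y: "Y \<noteq> 0" and z: "z = t - 1 - Y" "z * (Y - 1) = Y * (4 - X)" "z\<^sup>2 = t * X * Y"
  shows "(X\<^sup>2 + 16) * (t - 1) = X * (t ^ 3 - 8 * t\<^sup>2 + 12 * t - 8)"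
proof -
  txt \<open>\<open>L\<close> is palindromic in \<open>Y\<close>, so \<open>Y \<mapsto> 1 / Y\<close> is the conjugation that sends \<open>X = K / Y\<close>
    to \<open>K' / Y = 16 / X\<close>.\<close>
  define K where "K = (4 - t) * Y + Y\<^sup>2 + (t - 1)"
  define K' where "K' = (4 - t) * Y + 1 + (t - 1) * Y\<^sup>2"
  define L where "L = (1 - t) * Y\<^sup>2 + (t\<^sup>2 - 6 * t + 2) * Y + (1 - t)"
  have K: "X * Y = K"
    using z(2) unfolding z(1) K_def by (simp add: algebra_simps power2_eq_square)
  have "z\<^sup>2 = t * K" using z(3) K by (simp add: mult.assoc)
  then have "L = 0"
    unfolding z(1) K_def L_def by (simp add: algebra_simps power2_eq_square)
  moreover have "K * K' - 16 * Y\<^sup>2 = - ((Y - 1)\<^sup>2 * L)"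
    unfolding K_def K'_def L_def by (simp add: algebra_simps power2_eq_square)
  moreover have "(t - 1) * (K + K') = Y * (t ^ 3 - 8 * t\<^sup>2 + 12 * t - 8) - t * L"
    unfolding K_def K'_def L_def by (simp add: algebra_simps power2_eq_square power3_eq_cube)
  ultimately have KK: "K * K' = 16 * Y\<^sup>2" "(t - 1) * (K + K') = Y * (t ^ 3 - 8 * t\<^sup>2 + 12 * t - 8)"
    by simp_all
  have "Y\<^sup>2 * ((X\<^sup>2 + 16) * (t - 1)) = (K\<^sup>2 + 16 * Y\<^sup>2) * (t - 1)"
    unfolding K[symmetric] by (simp add: algebra_simps power2_eq_square)
  also have "\<dots> = K * ((t - 1) * (K + K'))"
    unfolding KK(1)[symmetric] by (simp add: algebra_simps power2_eq_square)
  also have "\<dots> = Y\<^sup>2 * (X * (t ^ 3 - 8 * t\<^sup>2 + 12 * t - 8))"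
    unfolding KK(2) unfolding K[symmetric] by (simp add: algebra_simps power2_eq_square)
  finally show ?thesis using Y by simp
qed

text \<open>With \<open>P = a * b\<close> and \<open>Q = b * c\<close>, \<open>X\<close> is
  \<open>P * Q\<close> and \<open>r\<close> is \<open>P / Q + Q / P\<close>. Both are symmetric in
  \<open>a\<close> and \<open>c\<close>, so the claim can be expressed in \<open>s\<close>,
  \<open>p\<close> and \<open>b\<close>.\<close>

lemma cubic_modular_elimination:
  fixes a b c :: complex
  assumes nz: "a \<noteq> 0" "b \<noteq> 0" "c \<noteq> 0" and ne: "a \<noteq> c"
    and ab: "a ^ 4 + b ^ 4 = a ^ 3 * b ^ 3 + 4 * a * b"
    and cb: "c ^ 4 + b ^ 4 = c ^ 3 * b ^ 3 + 4 * c * b"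
  defines "X \<equiv> a * b\<^sup>2 * c" and "r \<equiv> a / c + c / a"
  shows "(X + 16 / X) * (r + 1) = r ^ 3 - 2 * r\<^sup>2 - 8 * r - 8"
proof -
  txt \<open>Both \<open>a\<close> and \<open>c\<close> are roots of \<open>x\<^sup>4 - b\<^sup>3 x\<^sup>3 - 4 b x + b\<^sup>4\<close>; dividing by \<open>a - c\<close> gives two
    relations in the elementary symmetric functions.\<close>
  define s p where "s = a + c" and "p = a * c"
  \<comment> \<open>These are invariant under multiplying \<open>a\<close>, \<open>c\<close> by
    \<zeta> and \<open>b\<close> by \<zeta>^3 for \<zeta>^8 = 1, the ambiguity of the eighth
    root.\<close>
  define t Y z where "t = s\<^sup>2 / p" and "Y = b ^ 4 / p\<^sup>2" and "z = s * b ^ 3 / p"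
  have p0: "p \<noteq> 0" and X0: "X \<noteq> 0" using nz by (auto simp: p_def X_def)
  \<comment> \<open>This combination cancels the linear terms of the two quartics; their plain
    difference, used next, cancels the constant terms.\<close>
  have "(a - c) * (p\<^sup>2 + b ^ 4 + p * s * b ^ 3 - p * s\<^sup>2) =
      a * (c ^ 4 + b ^ 4 - (c ^ 3 * b ^ 3 + 4 * c * b)) - c * (a ^ 4 + b ^ 4 - (a ^ 3 * b ^ 3 + 4 * a * b))"
    unfolding s_def p_def by (simp add: algebra_simps eval_nat_numeral)
  then have 1: "p\<^sup>2 + b ^ 4 + p * s * b ^ 3 - p * s\<^sup>2 = 0" using ne ab cb by simp
  have "(a - c) * (s ^ 3 - 2 * p * s - b ^ 3 * (s\<^sup>2 - p) - 4 * b) =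
      (a ^ 4 + b ^ 4 - (a ^ 3 * b ^ 3 + 4 * a * b)) - (c ^ 4 + b ^ 4 - (c ^ 3 * b ^ 3 + 4 * c * b))"
    unfolding s_def p_def by (simp add: algebra_simps eval_nat_numeral)
  then have D: "s ^ 3 - 2 * p * s - b ^ 3 * (s\<^sup>2 - p) - 4 * b = 0" using ne ab cb by simp
  \<comment> \<open>The multipliers \<open>s\<close> and \<open>p\<close> are chosen so that the
    cubic and quadratic terms in \<open>s\<close> cancel.\<close>
  have "p\<^sup>2 * (b ^ 3 - s) + b ^ 4 * s - 4 * b * p =
      s * (p\<^sup>2 + b ^ 4 + p * s * b ^ 3 - p * s\<^sup>2) + p * (s ^ 3 - 2 * p * s - b ^ 3 * (s\<^sup>2 - p) - 4 * b)"
    by (simp add: algebra_simps eval_nat_numeral)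
  then have 2: "p\<^sup>2 * (b ^ 3 - s) + b ^ 4 * s = 4 * b * p"
    unfolding 1 D by simp
  have X: "X = p * b\<^sup>2" by (simp add: X_def p_def)
  have r: "r = t - 2"
    using nz unfolding r_def t_def s_def p_def by (simp add: field_simps power2_eq_square)
  have "(X\<^sup>2 + 16) * (t - 1) = X * (t ^ 3 - 8 * t\<^sup>2 + 12 * t - 8)"
  proof (rule palindromic_elimination)
    show "Y \<noteq> 0" using nz p0 by (simp add: Y_def)
    have "p\<^sup>2 * (z - (t - 1 - Y)) = p\<^sup>2 + b ^ 4 + p * s * b ^ 3 - p * s\<^sup>2"
      using p0 unfolding z_def t_def Y_def by (simp add: field_simps power2_eq_square)
    with 1 p0 show "z = t - 1 - Y" by simp
    have "p ^ 3 * (z * (Y - 1) - Y * (4 - X)) = b ^ 3 * (p\<^sup>2 * (b ^ 3 - s) + b ^ 4 * s - 4 * b * p)"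
      using p0 unfolding z_def Y_def X by (simp add: field_simps eval_nat_numeral)
    with 2 p0 show "z * (Y - 1) = Y * (4 - X)" by simp
    show "z\<^sup>2 = t * X * Y"
      using p0 unfolding z_def Y_def X t_def by (simp add: field_simps eval_nat_numeral)
  qed
  then have "(X + 16 / X) * (t - 1) = t ^ 3 - 8 * t\<^sup>2 + 12 * t - 8"
    using X0 by (simp add: field_simps power2_eq_square)
  then show ?thesis
    unfolding r by (simp add: algebra_simps power2_eq_square power3_eq_cube)
qed

text \<open>Here \<open>p\<close>, \<open>s\<close>, \<open>m\<close> are \<open>Phi q\<close>,
  \<open>Psi q\<close>, \<open>Phi (- q)\<close>, and the primed letters their values at
  \<open>q ^ 3\<close>. The fourth power of the cubic identity is compared with the product of the
  quartic ones; \<open>s\<close> and \<open>s'\<close> then cancel.\<close>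

lemma modular_theta_elimination:
  fixes q U V p p' m m' s s' :: complex
  assumes q: "q \<noteq> 0" and s: "s \<noteq> 0" "s' \<noteq> 0"
    and quartic: "p ^ 4 = q * s ^ 4 + m ^ 4" "p' ^ 4 = q ^ 3 * s' ^ 4 + m' ^ 4"
    and cubic: "p * p' = q * s * s' + m * m'"
    and m: "2 * m = U\<^sup>2 * s" "2 * m' = V\<^sup>2 * s'"
  shows "(q * U ^ 4 + V ^ 4)\<^sup>2 = (U ^ 3 * V ^ 3 + 4 * q * U * V)\<^sup>2"
proof -
  have m': "m = U\<^sup>2 * s / 2" "m' = V\<^sup>2 * s' / 2" using m by (auto simp: field_simps)
  have "(16 * q + U ^ 8) * (16 * q ^ 3 + V ^ 8) * (s * s') ^ 4 = 256 * (p ^ 4 * p' ^ 4)"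
    unfolding quartic m' by (simp add: field_simps flip: power_mult)
  also have "\<dots> = 256 * (p * p') ^ 4" by (simp add: power_mult_distrib)
  also have "p * p' = (4 * q + U\<^sup>2 * V\<^sup>2) / 4 * (s * s')"
    unfolding cubic m' by (simp add: field_simps)
  also have "256 * ((4 * q + U\<^sup>2 * V\<^sup>2) / 4 * (s * s')) ^ 4 = (4 * q + U\<^sup>2 * V\<^sup>2) ^ 4 * (s * s') ^ 4"
    by (simp add: power_mult_distrib power_divide)
  finally have "(16 * q + U ^ 8) * (16 * q ^ 3 + V ^ 8) = (4 * q + U\<^sup>2 * V\<^sup>2) ^ 4"
    using s by simp
  \<comment> \<open>The terms \<open>256 * q ^ 4\<close> and \<open>U ^ 8 * V ^ 8\<close> cancel on
    the right; what remains is \<open>16 * q\<close> times a difference of squares.\<close>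
  moreover have "16 * (q * ((q * U ^ 4 + V ^ 4)\<^sup>2 - (U ^ 3 * V ^ 3 + 4 * q * U * V)\<^sup>2))
      = (16 * q + U ^ 8) * (16 * q ^ 3 + V ^ 8) - (4 * q + U\<^sup>2 * V\<^sup>2) ^ 4"
    by (simp add: algebra_simps eval_nat_numeral)
  ultimately show ?thesis using q by simp
qed

subsection \<open>Analytic continuation\<close>

text \<open>The eta quotient \<eta>(\<tau>) / \<eta>(4\<tau>) stripped of its factor q^(-1/8), which
  makes it holomorphic at 0.\<close>

definition eta_ratio :: "complex \<Rightarrow> complex" where
  "eta_ratio q = ramanujan_f (- q) / ramanujan_f (- (q ^ 4))"

text \<open>The polynomial partial products converge uniformly on closed discs inside the unit disc:
  there the norm has a maximum \<open>r < 1\<close>, and the Weierstrass test applies with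
  \<open>r ^ Suc n\<close>.\<close>

lemma holomorphic_ramanujan_f: "(\<lambda>q. ramanujan_f (- q)) holomorphic_on ball 0 1"
  unfolding ramanujan_f_minus
proof (rule holomorphic_uniform_sequence)
  show "(\<lambda>q. \<Prod>k<n. 1 - q ^ Suc k) holomorphic_on ball 0 1" for n :: nat
    by (intro holomorphic_intros)
  fix x :: complex assume "x \<in> ball 0 1"
  then obtain d where d: "d > 0" "cball x d \<subseteq> ball 0 1"
    using open_contains_cball[of "ball 0 (1 :: real)"] by (meson open_ball open_contains_cball)
  obtain r where r: "\<And>y. y \<in> cball x d \<Longrightarrow> norm y \<le> r" "r < 1"
  proof -
    have "compact (norm ` cball x d)" "norm ` cball x d \<noteq> {}"
      using d(1) by (auto intro!: compact_continuous_image continuous_intros)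
    from compact_attains_sup[OF this] obtain y where "y \<in> cball x d" "\<forall>z\<in>cball x d. norm z \<le> norm y"
      by auto
    then show ?thesis using that[of "norm y"] d(2) by auto
  qed
  have "norm x \<le> r" using r(1)[of x] d(1) by simp
  then have r0: "0 \<le> r" using norm_ge_zero order_trans by blast
  have "uniformly_convergent_on (cball x d) (\<lambda>N y. \<Sum>n<N. norm ((1 - y ^ Suc n) - 1))"
  proof (rule Weierstrass_m_test')
    show "norm (norm ((1 - y ^ Suc n) - 1)) \<le> r ^ Suc n" if "y \<in> cball x d" for n y
      using power_mono[OF r(1)[OF that], of "Suc n"] by (simp add: norm_mult norm_power)
    show "summable (\<lambda>n. r ^ Suc n)"
      using r0 r(2) by (simp add: summable_geometric summable_mult)
  qed
  then have "uniformly_convergent_on (cball x d) (\<lambda>N y. \<Prod>n<N. 1 - y ^ Suc n)"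
    by (intro uniformly_convergent_on_prod') (auto intro!: continuous_intros)
  then obtain g where g: "uniform_limit (cball x d) (\<lambda>N y. \<Prod>n<N. 1 - y ^ Suc n) g sequentially"
    by (auto simp: uniformly_convergent_on_def)
  have "g y = (\<Prod>n. 1 - y ^ Suc n)" if "y \<in> cball x d" for y
  proof (rule LIMSEQ_unique[OF tendsto_uniform_limitI[OF g that]])
    have "norm y < 1" using that d(2) by auto
    then show "(\<lambda>N. \<Prod>n<N. 1 - y ^ Suc n) \<longlonglongrightarrow> (\<Prod>n. 1 - y ^ Suc n)"
      using qpoch_tendsto[of y] by (simp add: qpoch_def[abs_def] ramanujan_f_minus)
  qed
  then have "uniform_limit (cball x d) (\<lambda>N y. \<Prod>n<N. 1 - y ^ Suc n) (\<lambda>y. \<Prod>n. 1 - y ^ Suc n) sequentially"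
    using g by (subst (asm) uniform_limit_cong') auto
  with d show "\<exists>d>0. cball x d \<subseteq> ball 0 1 \<and>
      uniform_limit (cball x d) (\<lambda>N y. \<Prod>n<N. 1 - y ^ Suc n) (\<lambda>y. \<Prod>n. 1 - y ^ Suc n) sequentially"
    by blast
qed simp

lemma holomorphic_eta_ratio:
  assumes "k > 0"
  shows "(\<lambda>q. eta_ratio (q ^ k)) holomorphic_on ball 0 1"
proof -
  have *: "(\<lambda>q. ramanujan_f (- (q ^ j))) holomorphic_on ball 0 1" if "j > 0" for j
  proof -
    have "(\<lambda>q. q ^ j) ` ball 0 1 \<subseteq> ball (0 :: complex) 1"
      using norm_power_less_one[OF _ that] by auto
    then show ?thesis
      using holomorphic_on_compose_gen[OF _ holomorphic_ramanujan_f, of "\<lambda>q. q ^ j" "ball 0 1"]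
      by (simp add: o_def holomorphic_intros)
  qed
  show ?thesis
    unfolding eta_ratio_def power_mult[symmetric]
    using assms by (intro holomorphic_intros * ramanujan_f_nonzero norm_power_less_one) auto
qed

lemma eta_ratio_nonzero: "norm q < 1 \<Longrightarrow> eta_ratio q \<noteq> 0"
  using ramanujan_f_nonzero[of q] ramanujan_f_nonzero[of "q ^ 4"] norm_power_less_one[of q 4]
  by (simp add: eta_ratio_def)

lemma tendsto_eta_ratio:
  assumes "k > 0"
  shows "((\<lambda>q. eta_ratio (q ^ k)) \<longlongrightarrow> 1) (at 0)"
proof -
  have "isCont (\<lambda>q. eta_ratio (q ^ k)) 0"
    using holomorphic_on_imp_continuous_on[OF holomorphic_eta_ratio[OF assms]]
    by (rule continuous_on_interior) simp
  moreover have "eta_ratio (0 ^ k) = 1"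
    using assms ramanujan_f_nonzero[of 0] by (simp add: eta_ratio_def zero_power)
  ultimately show ?thesis by (simp add: isCont_def)
qed

text \<open>The quotient of the product formulas for \<open>Phi (- q)\<close> and
  \<open>Psi q\<close>, in which \<open>ramanujan_f (- (q\<^sup>2))\<close> cancels.\<close>

lemma eta_ratio_theta:
  assumes q: "q \<noteq> 0" "norm q < 1"
  shows "2 * Phi (- q) = eta_ratio q ^ 2 * Psi q" and "Psi q \<noteq> 0"
proof -
  have E: "ramanujan_f (- (q\<^sup>2)) \<noteq> 0" "ramanujan_f (- (q ^ 4)) \<noteq> 0"
    using q by (auto intro!: ramanujan_f_nonzero norm_power_less_one)
  have "2 * Phi (- q) * ramanujan_f (- (q\<^sup>2)) * ramanujan_f (- (q ^ 4)) ^ 2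
      = ramanujan_f (- q) ^ 2 * (Psi q * ramanujan_f (- (q\<^sup>2)))"
    using Phi_product[OF q] Psi_product[OF q] by algebra
  then show "2 * Phi (- q) = eta_ratio q ^ 2 * Psi q"
    using E by (simp add: eta_ratio_def field_simps)
  show "Psi q \<noteq> 0" using Psi_product[OF q] E by auto
qed

section \<open>The relation near zero and its continuation to the unit disc\<close>

lemma eventually_norm_less_one_at_0: "\<forall>\<^sub>F q in at (0 :: complex). norm q < 1 \<and> q \<noteq> 0"
  unfolding eventually_at by (intro exI[of _ 1]) (auto simp: dist_norm)

text \<open>The squared relation leaves a sign open. Both sides tend to 1 at 0, so their sum
  \<open>?S\<close> tends to 2, which excludes the minus sign.\<close>

lemma eventually_eta_ratio_cubic:
  "\<forall>\<^sub>F q in at 0. q * eta_ratio q ^ 4 + eta_ratio (q ^ 3) ^ 4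
      = eta_ratio q ^ 3 * eta_ratio (q ^ 3) ^ 3 + 4 * q * eta_ratio q * eta_ratio (q ^ 3)"
proof -
  let ?S = "\<lambda>q. q * eta_ratio q ^ 4 + eta_ratio (q ^ 3) ^ 4
      + (eta_ratio q ^ 3 * eta_ratio (q ^ 3) ^ 3 + 4 * q * eta_ratio q * eta_ratio (q ^ 3))"
  have "(?S \<longlongrightarrow> 0 * 1 ^ 4 + 1 ^ 4 + (1 ^ 3 * 1 ^ 3 + 4 * 0 * 1 * 1)) (at 0)"
    using tendsto_eta_ratio[of 1] tendsto_eta_ratio[of 3] by (intro tendsto_intros) simp_all
  then have "\<forall>\<^sub>F q in at 0. ?S q \<noteq> 0"
    by (rule tendsto_imp_eventually_ne) simp
  with eventually_norm_less_one_at_0 show ?thesis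
  proof eventually_elim
    case (elim q)
    then have q: "q \<noteq> 0" "norm q < 1" "q ^ 3 \<noteq> 0" "norm (q ^ 3) < 1"
      by (auto intro: norm_power_less_one)
    have "(q * eta_ratio q ^ 4 + eta_ratio (q ^ 3) ^ 4)\<^sup>2
      = (eta_ratio q ^ 3 * eta_ratio (q ^ 3) ^ 3 + 4 * q * eta_ratio q * eta_ratio (q ^ 3))\<^sup>2"
      by (rule modular_theta_elimination[OF q(1) eta_ratio_theta(2)[OF q(1,2)] eta_ratio_theta(2)[OF q(3,4)]
            Phi_quartic[OF q(1,2)] Phi_quartic[OF q(3,4)] Phi_cubic[OF q(1,2)]
            eta_ratio_theta(1)[OF q(1,2)] eta_ratio_theta(1)[OF q(3,4)]])
    with elim show ?case by (auto simp: power2_eq_iff eq_neg_iff_add_eq_0)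
  qed
qed

text \<open>The target relation multiplied out to a polynomial, so that it stays holomorphic at \<open>q = 0\<close>.\<close>

definition cleared :: "complex \<Rightarrow> complex \<Rightarrow> complex \<Rightarrow> complex \<Rightarrow> complex" where
  "cleared q U V W = (let A = q * U; B = A * W; H = U * V\<^sup>2 * W; N = A\<^sup>2 + W\<^sup>2 in
     (H\<^sup>2 + 16 * q ^ 4) * (N + B) * B\<^sup>2
     - q\<^sup>2 * H * (N ^ 3 - 2 * N\<^sup>2 * B - 8 * N * B\<^sup>2 - 8 * B ^ 3))"

text \<open>\<open>cleared\<close> is the nonzero factor \<open>q\<^sup>2 * H * B ^ 3\<close> times
  the difference of the two sides, because \<open>N = r * B\<close> and
  \<open>X = H / q\<^sup>2\<close>.\<close>

lemma cleared_eq_0_iff: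
  assumes nz: "q \<noteq> 0" "U \<noteq> 0" "V \<noteq> 0" "W \<noteq> 0"
  defines "X \<equiv> U * V\<^sup>2 * W / q\<^sup>2" and "r \<equiv> q * U / W + W / (q * U)"
  shows "cleared q U V W = 0 \<longleftrightarrow> (X + 16 / X) * (r + 1) = r ^ 3 - 2 * r\<^sup>2 - 8 * r - 8"
proof -
  define B where "B = q * U * W"
  define H where "H = U * V\<^sup>2 * W"
  have B0: "B \<noteq> 0" and H0: "H \<noteq> 0" using nz by (auto simp: B_def H_def)
  have N: "(q * U)\<^sup>2 + W\<^sup>2 = r * B"
    using nz by (simp add: r_def B_def field_simps power2_eq_square)
  have "cleared q U V W = (H\<^sup>2 + 16 * q ^ 4) * (r * B + B) * B\<^sup>2
     - q\<^sup>2 * H * ((r * B) ^ 3 - 2 * (r * B)\<^sup>2 * B - 8 * (r * B) * B\<^sup>2 - 8 * B ^ 3)"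
    unfolding cleared_def Let_def N B_def H_def ..
  also have "\<dots> = q\<^sup>2 * H * B ^ 3 * ((X + 16 / X) * (r + 1) - (r ^ 3 - 2 * r\<^sup>2 - 8 * r - 8))"
    using nz H0 unfolding X_def H_def[symmetric] by (simp add: field_simps eval_nat_numeral)
  finally show ?thesis using nz B0 H0 by simp
qed

text \<open>Division by \<open>z ^ 12\<close>, for \<open>z\<close> an eighth root of
  \<open>q\<close>, removes \<open>q\<close> from the relation. With \<open>z ^ 3\<close> in place
  of \<open>z\<close> it serves \<open>q ^ 3\<close> as well.\<close>

lemma cubic_modular_rescale:
  fixes z U V :: complex
  assumes z: "z \<noteq> 0" and UV: "z ^ 8 * U ^ 4 + V ^ 4 = U ^ 3 * V ^ 3 + 4 * z ^ 8 * U * V"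
  shows "(U / z) ^ 4 + (V / z ^ 3) ^ 4 = (U / z) ^ 3 * (V / z ^ 3) ^ 3 + 4 * (U / z) * (V / z ^ 3)"
proof -
  have "(U / z) ^ 4 + (V / z ^ 3) ^ 4 = (z ^ 8 * U ^ 4 + V ^ 4) / z ^ 12"
    using z by (simp add: field_simps eval_nat_numeral)
  also have "\<dots> = (U / z) ^ 3 * (V / z ^ 3) ^ 3 + 4 * (U / z) * (V / z ^ 3)"
    unfolding UV using z by (simp add: field_simps eval_nat_numeral)
  finally show ?thesis .
qed

lemma eventually_cleared:
  "\<forall>\<^sub>F q in at 0. cleared q (eta_ratio q) (eta_ratio (q ^ 3)) (eta_ratio (q ^ 9)) = 0"
proof -
  \<comment> \<open>The difference tends to -1 and equals \<open>z ^ 9 * (a - c)\<close> below, so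
    the two roots are distinct near 0.\<close>
  have "((\<lambda>q. q * eta_ratio q - eta_ratio (q ^ 9)) \<longlongrightarrow> 0 * 1 - 1) (at 0)"
    using tendsto_eta_ratio[of 1] tendsto_eta_ratio[of 9] by (intro tendsto_intros) simp_all
  then have ne: "\<forall>\<^sub>F q in at 0. q * eta_ratio q - eta_ratio (q ^ 9) \<noteq> 0"
    by (rule tendsto_imp_eventually_ne) simp
  have "filterlim (\<lambda>q :: complex. q ^ 3) (at 0) (at 0)"
    unfolding filterlim_at by (auto intro!: tendsto_eq_intros simp: eventually_at_filter)
  then have c3: "\<forall>\<^sub>F q in at 0. q ^ 3 * eta_ratio (q ^ 3) ^ 4 + eta_ratio (q ^ 9) ^ 4
      = eta_ratio (q ^ 3) ^ 3 * eta_ratio (q ^ 9) ^ 3 + 4 * q ^ 3 * eta_ratio (q ^ 3) * eta_ratio (q ^ 9)"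
    using eventually_compose_filterlim[OF eventually_eta_ratio_cubic, of "\<lambda>q. q ^ 3" "at 0"]
    by (simp flip: power_mult)
  from eventually_norm_less_one_at_0 eventually_eta_ratio_cubic ne c3
  show ?thesis
  proof eventually_elim
    case (elim q)
    define U V W where "U = eta_ratio q" and "V = eta_ratio (q ^ 3)" and "W = eta_ratio (q ^ 9)"
    have nz: "q \<noteq> 0" "U \<noteq> 0" "V \<noteq> 0" "W \<noteq> 0"
      using elim(1) by (auto simp: U_def V_def W_def eta_ratio_nonzero norm_power_less_one)
    \<comment> \<open>Any eighth root will do, since the conclusion involves only integral powers of
      \<open>q\<close>.\<close>
    obtain z where z: "q = z ^ 8"
      using exists_complex_root[of 8 q] by auto
    have z0: "z \<noteq> 0" using nz z by auto
    define a b c where "a = U / z" and "b = V / z ^ 3" and "c = W / z ^ 9"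
    have ab: "a ^ 4 + b ^ 4 = a ^ 3 * b ^ 3 + 4 * a * b"
      unfolding a_def b_def using elim(2)
      by (intro cubic_modular_rescale z0) (simp add: U_def V_def flip: z)
    have z3: "(z ^ 3) ^ 8 = q ^ 3" by (simp add: z flip: power_mult)
    have "b ^ 4 + c ^ 4 = b ^ 3 * c ^ 3 + 4 * b * c"
      using cubic_modular_rescale[of "z ^ 3" V W] z0 elim(4) unfolding z3
      by (simp add: b_def c_def V_def W_def flip: power_mult)
    \<comment> \<open>The relation is symmetric in its two arguments; swapping them makes
      \<open>b\<close> the common parameter of both quartics.\<close>
    then have cb: "c ^ 4 + b ^ 4 = c ^ 3 * b ^ 3 + 4 * c * b" by (simp add: mult_ac add_ac)
    have e: "q * U - W = z ^ 9 * (a - c)"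
      using z0 by (simp add: a_def c_def z right_diff_distrib) (simp add: eval_nat_numeral)
    have "a \<noteq> c"
      using elim(3) unfolding U_def[symmetric] W_def[symmetric] e by auto
    from cubic_modular_elimination[OF _ _ _ this ab cb]
    have "(a * b\<^sup>2 * c + 16 / (a * b\<^sup>2 * c)) * (a / c + c / a + 1)
      = (a / c + c / a) ^ 3 - 2 * (a / c + c / a)\<^sup>2 - 8 * (a / c + c / a) - 8"
      using nz z0 by (simp add: a_def b_def c_def)
    moreover have "a * b\<^sup>2 * c = U * V\<^sup>2 * W / q\<^sup>2" "a / c = q * U / W" "c / a = W / (q * U)"
      using z0 nz by (simp_all add: a_def b_def c_def z field_simps eval_nat_numeral)
    ultimately show ?case
      using cleared_eq_0_iff[OF nz] by (simp add: U_def V_def W_def)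
  qed
qed

text \<open>The sign choice and \<open>a \<noteq> c\<close> were established only near 0. The zeros
  there accumulate at the interior point 0, so the identity theorem covers the whole disc.\<close>

lemma cleared_eq_0:
  assumes "norm q < 1"
  shows "cleared q (eta_ratio q) (eta_ratio (q ^ 3)) (eta_ratio (q ^ 9)) = 0"
proof -
  let ?g = "\<lambda>q. cleared q (eta_ratio q) (eta_ratio (q ^ 3)) (eta_ratio (q ^ 9))"
  have hol: "?g holomorphic_on ball 0 1"
    using holomorphic_eta_ratio[of 1] holomorphic_eta_ratio[of 3] holomorphic_eta_ratio[of 9]
    unfolding cleared_def Let_def by (intro holomorphic_intros) simp_all
  let ?Z = "{z \<in> ball 0 1. ?g z = 0}"
  have "\<forall>\<^sub>F z in at 0. z \<in> ?Z"
    using eventually_norm_less_one_at_0 eventually_cleared by eventually_elim simp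
  then have "0 islimpt ?Z"
    unfolding islimpt_conv_frequently_at by (rule eventually_frequently[rotated]) simp
  show ?thesis
  proof (rule analytic_continuation[OF hol open_ball connected_ball _ _ \<open>0 islimpt ?Z\<close>])
    show "?Z \<subseteq> ball 0 1" "0 \<in> ball (0 :: complex) 1" "q \<in> ball 0 1"
      using assms by auto
  qed blast
qed

theorem theorem3p1:
  fixes q q8 P Q :: complex
  assumes "0 < norm q" and "norm q < 1"
    and "q8 ^ 8 = q"
    and "P = ramanujan_f (- q) * ramanujan_f (- (q ^ 3)) /
              (q8 ^ 4 * ramanujan_f (- (q ^ 4)) * ramanujan_f (- (q ^ 12)))"
    and "Q = ramanujan_f (- (q ^ 3)) * ramanujan_f (- (q ^ 9)) /
              (q8 ^ 12 * ramanujan_f (- (q ^ 12)) * ramanujan_f (- (q ^ 36)))"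
  shows "(P * Q + 16 / (P * Q)) * (P / Q + Q / P + 1) =
           (P / Q + Q / P) ^ 3 - 2 * (P / Q + Q / P) ^ 2 - 8 * (P / Q + Q / P) - 8"
proof -
  define U V W where "U = eta_ratio q" and "V = eta_ratio (q ^ 3)" and "W = eta_ratio (q ^ 9)"
  have nz: "q \<noteq> 0" "U \<noteq> 0" "V \<noteq> 0" "W \<noteq> 0"
    using assms(1,2) by (auto simp: U_def V_def W_def eta_ratio_nonzero norm_power_less_one)
  have q80: "q8 \<noteq> 0" using nz(1) assms(3) by auto
  have P: "P = U * V / q8 ^ 4"
    unfolding assms(4) by (simp add: U_def V_def eta_ratio_def field_simps flip: power_mult)
  have Q: "Q = V * W / q8 ^ 12"
    unfolding assms(5) by (simp add: V_def W_def eta_ratio_def field_simps flip: power_mult)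
  \<comment> \<open>The eighth root disappears: \<open>P * Q\<close> carries \<open>q8 ^ 16\<close>
    and \<open>P / Q\<close> carries \<open>q8 ^ 8\<close>.\<close>
  have "P * Q = U * V\<^sup>2 * W / q\<^sup>2" "P / Q = q * U / W" "Q / P = W / (q * U)"
    using q80 nz unfolding P Q assms(3)[symmetric] by (simp_all add: field_simps eval_nat_numeral)
  moreover have "cleared q U V W = 0"
    using cleared_eq_0[OF assms(2)] by (simp add: U_def V_def W_def)
  ultimately show ?thesis
    using cleared_eq_0_iff[OF nz] by simp
qed

end
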